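(* In the heterogeneous user model ($\theta_1<\theta_2$, $\eta=1/2$) the optimal equilibrium flow $\hat{x}_H$ under the side-payment mechanism and the resulting optimal social welfare $SW_g$ are as follows. (i) Social optimum: if $x_H^*\le x_{IR}$, then $\hat{x}_H=x_H^*$ and $SW_g=SW(x_H^* )$. (ii) Full participation: if $x_H^*>x_{IR}$ and $SW(x_{IR})\ge SW_{1/2}(\tilde{x}_H)$, then $\hat{x}_H=x_{IR}$ and $SW_g=SW(x_{IR})$. (iii) Half participation: if $x_H^*>x_{IR}$ and $SW(x_{IR})<SW_{1/2}(\tilde{x}_H)$, then $\hat{x}_H=\tilde{x}_H$ and $SW_g=SW_{1/2}(\tilde{x}_H)$. Moreover, over all parameters $\theta_1<\theta_2$, $c_H$ and content functions $Q_1$, the side-payment mechanism achieves $$PoA_g=\inf_{\theta_1,\theta_2,c_H,Q_1}\frac{SW_g}{SW(x_H^* )}=\frac12 .$$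
   Context: A unit mass of non-atomic users chooses between path $H$ (travel cost $c_H>0$) and path $L$ (cost $0$). Half of the users have valuation $\theta_1$ and half $\theta_2$, $0<\theta_1<\theta_2$; $\theta_0=(\theta_1+\theta_2)/2$. $Q_1:[0,1]\to[0,\infty)$ is continuous, concave, nondecreasing, $Q_1(0)=0$; $Q(x,b)=Q_1(x)+Q_1(b-x)$ is the content when a mass $b$ participates and $x$ of it takes $H$; $Q(\cdot,1)$ is strictly increasing on $[0,1/2]$. Side-payment mechanism: each $L$-user pays $g(x_H)$, and each $H$-user receives $\frac{b-x_H}{x_H}g(x_H)$ (budget balance), where $b$ is the participating mass. Any flow $x_H$ can be made a stable equilibrium by a suitable $g$; at such an equilibrium every user's total cost (travel plus payment minus subsidy) is $x_Hc_H/b$, so a participating type-$i$ user has payoff $\theta_iQ(x_H,b)-x_Hc_H/b$, which must be $\ge0$ (individual rationality, IR); users with negative payoff do not participate. Full-participation welfare ($b=1$): $SW(x)=\theta_0Q(x,1)-xc_H$, and $x_H^*\in\arg\max_{0\le x\le1}SW(x)$. The IR condition of type-1 users under full participation is $\theta_1Q(x,1)-xc_H\ge0$, which holds exactly for $x\in[0,x_{IR}]$, where $x_{IR}$ is the unique solution of $\theta_1Q(x,1)=xc_H$ ($x_{IR}=1$ if there is no solution in $[0,1]$). Half-participation ($b=1/2$, only type-2 users): $SW_{1/2}(x)=\tfrac12\theta_2Q(x,\tfrac12)-xc_H$, and $\tilde{x}_H\in\arg\max_{x\in[0,1/2]}SW_{1/2}(x)$. The admissible outcomes are: full participation with $x\in[0,x_{IR}]$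 and welfare $SW(x)$, or half participation with $x\in[x_{IR},1/2]$ and welfare $SW_{1/2}(x)$. $SW_g$ is the largest welfare among admissible outcomes, and $\hat{x}_H$ an outcome attaining it. *)

theory Defs
  imports "HOL-Analysis.Analysis"
begin

definition Q :: "(real \<Rightarrow> real) \<Rightarrow> real \<Rightarrow> real \<Rightarrow> real" where
  "Q Q1 x b = Q1 x + Q1 (b - x)"

definition content_function :: "(real \<Rightarrow> real) \<Rightarrow> bool" where
  "content_function Q1 \<longleftrightarrow>
     continuous_on {0..1} Q1 \<and> concave_on {0..1} Q1 \<and> mono_on {0..1} Q1 \<and>
     (\<forall>x\<in>{0..1}. 0 \<le> Q1 x) \<and> Q1 0 = 0 \<and>
     strict_mono_on {0..1/2} (\<lambda>x. Q Q1 x 1)"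

definition model :: "real \<Rightarrow> real \<Rightarrow> real \<Rightarrow> (real \<Rightarrow> real) \<Rightarrow> bool" where
  "model \<theta>1 \<theta>2 cH Q1 \<longleftrightarrow> 0 < \<theta>1 \<and> \<theta>1 < \<theta>2 \<and> 0 < cH \<and> content_function Q1"

text \<open>With participating mass \<open>b\<close> and payment rule \<open>g\<close>, the \<open>b - x\<close> users of path L pay
  \<open>g x\<close> each, and what they pay is shared equally among the \<open>x\<close> users of path H.\<close>

definition L_cost :: "(real \<Rightarrow> real) \<Rightarrow> real \<Rightarrow> real" where
  "L_cost g x = g x"

definition H_cost :: "real \<Rightarrow> real \<Rightarrow> (real \<Rightarrow> real) \<Rightarrow> real \<Rightarrow> real" where
  "H_cost cH b g x = cH - (b - x) / x * g x"

definition payoff :: "real \<Rightarrow> real \<Rightarrow> (real \<Rightarrow> real) \<Rightarrow> real \<Rightarrow> real \<Rightarrow> real" where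
  "payoff \<theta> cH Q1 b x = \<theta> * Q Q1 x b - x * cH / b"

text \<open>The cost subtracted in \<^const>\<open>payoff\<close> is the common cost at an interior equilibrium.\<close>

lemma equal_cost_iff:
  assumes "0 < x" "x < b"
  shows "H_cost cH b g x = L_cost g x \<longleftrightarrow> L_cost g x = x * cH / b"
  using assms by (auto simp: H_cost_def L_cost_def field_simps)

definition SW :: "real \<Rightarrow> real \<Rightarrow> real \<Rightarrow> (real \<Rightarrow> real) \<Rightarrow> real \<Rightarrow> real" where
  "SW \<theta>1 \<theta>2 cH Q1 x = (\<theta>1 + \<theta>2) / 2 * Q Q1 x 1 - x * cH"

definition SW_half :: "real \<Rightarrow> real \<Rightarrow> (real \<Rightarrow> real) \<Rightarrow> real \<Rightarrow> real" where
  "SW_half \<theta>2 cH Q1 x = 1/2 * \<theta>2 * Q Q1 x (1/2) - x * cH"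

lemma SW_eq_payoffs:
  "SW \<theta>1 \<theta>2 cH Q1 x = 1/2 * payoff \<theta>1 cH Q1 1 x + 1/2 * payoff \<theta>2 cH Q1 1 x"
  by (simp add: SW_def payoff_def field_simps)

lemma SW_half_eq_payoff: "SW_half \<theta>2 cH Q1 x = 1/2 * payoff \<theta>2 cH Q1 (1/2) x"
  by (simp add: SW_half_def payoff_def field_simps)

definition x_IR :: "real \<Rightarrow> real \<Rightarrow> (real \<Rightarrow> real) \<Rightarrow> real" where
  "x_IR \<theta>1 cH Q1 =
     (if \<exists>x\<in>{0..1}. \<theta>1 * Q Q1 x 1 = x * cH
      then THE x. x \<in> {0..1} \<and> \<theta>1 * Q Q1 x 1 = x * cH else 1)"

datatype outcome = Full real | Half real

fun admissible :: "real \<Rightarrow> real \<Rightarrow> (real \<Rightarrow> real) \<Rightarrow> outcome \<Rightarrow> bool" where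
  "admissible \<theta>1 cH Q1 (Full x) \<longleftrightarrow> x \<in> {0..x_IR \<theta>1 cH Q1}"
| "admissible \<theta>1 cH Q1 (Half x) \<longleftrightarrow> x \<in> {x_IR \<theta>1 cH Q1..1/2}"

fun welfare :: "real \<Rightarrow> real \<Rightarrow> real \<Rightarrow> (real \<Rightarrow> real) \<Rightarrow> outcome \<Rightarrow> real" where
  "welfare \<theta>1 \<theta>2 cH Q1 (Full x) = SW \<theta>1 \<theta>2 cH Q1 x"
| "welfare \<theta>1 \<theta>2 cH Q1 (Half x) = SW_half \<theta>2 cH Q1 x"

definition optimal_outcome :: "real \<Rightarrow> real \<Rightarrow> real \<Rightarrow> (real \<Rightarrow> real) \<Rightarrow> outcome \<Rightarrow> bool" where
  "optimal_outcome \<theta>1 \<theta>2 cH Q1 = is_arg_max (welfare \<theta>1 \<theta>2 cH Q1) (admissible \<theta>1 cH Q1)"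

definition SW_g :: "real \<Rightarrow> real \<Rightarrow> real \<Rightarrow> (real \<Rightarrow> real) \<Rightarrow> real" where
  "SW_g \<theta>1 \<theta>2 cH Q1 =
     (GREATEST w. \<exists>out. admissible \<theta>1 cH Q1 out \<and> w = welfare \<theta>1 \<theta>2 cH Q1 out)"

definition social_optimum :: "real \<Rightarrow> real \<Rightarrow> real \<Rightarrow> (real \<Rightarrow> real) \<Rightarrow> real \<Rightarrow> bool" where
  "social_optimum \<theta>1 \<theta>2 cH Q1 = is_arg_max (SW \<theta>1 \<theta>2 cH Q1) (\<lambda>x. x \<in> {0..1})"

definition half_optimum :: "real \<Rightarrow> real \<Rightarrow> (real \<Rightarrow> real) \<Rightarrow> real \<Rightarrow> bool" where
  "half_optimum \<theta>2 cH Q1 = is_arg_max (SW_half \<theta>2 cH Q1) (\<lambda>x. x \<in> {0..1/2})"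

definition welfare_ratios :: "real set" where
  "welfare_ratios =
     {SW_g \<theta>1 \<theta>2 cH Q1 / SW \<theta>1 \<theta>2 cH Q1 xs | \<theta>1 \<theta>2 cH Q1 xs.
        model \<theta>1 \<theta>2 cH Q1 \<and> social_optimum \<theta>1 \<theta>2 cH Q1 xs}"

definition PoA_g :: real where
  "PoA_g = Inf welfare_ratios"

lemma Q_zero_pos:
  assumes "content_function Q1"
  shows "0 < Q Q1 0 1"
proof -
  have m: "mono_on {0..1} Q1" and nn: "\<forall>x\<in>{0..1}. 0 \<le> Q1 x" and z: "Q1 0 = 0"
    and s: "strict_mono_on {0..1/2} (\<lambda>x. Q Q1 x 1)"
    using assms by (auto simp: content_function_def)
  have "Q Q1 0 1 < Q Q1 (1/2) 1" by (rule strict_mono_onD[OF s]) auto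
  moreover have "Q1 (1/2) \<le> Q1 1" by (rule mono_onD[OF m]) auto
  ultimately show ?thesis using z by (simp add: Q_def)
qed

lemma concave_on_Q:
  assumes "content_function Q1"
  shows "concave_on {0..1} (\<lambda>x. Q Q1 x 1)"
proof -
  have c: "concave_on {0..1} Q1" using assms by (simp add: content_function_def)
  have "concave_on {0..1} (\<lambda>x. Q1 (1 - x))"
    unfolding concave_on_iff
  proof (intro conjI ballI allI impI)
    fix x y u v :: real
    assume a: "x \<in> {0..1}" "y \<in> {0..1}" "0 \<le> u" "0 \<le> v" "u + v = 1"
    have e: "1 - (u *\<^sub>R x + v *\<^sub>R y) = u *\<^sub>R (1 - x) + v *\<^sub>R (1 - y)"
      using a(5) by (simp add: algebra_simps)
    show "u * Q1 (1 - x) + v * Q1 (1 - y) \<le> Q1 (1 - (u *\<^sub>R x + v *\<^sub>R y))"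
      unfolding e using c a unfolding concave_on_iff by auto
  qed simp
  with c show ?thesis unfolding Q_def by (rule concave_on_add)
qed

text \<open>The threshold is well defined, and it is exactly where the IR condition of type-1 users
  under full participation stops to hold.\<close>

lemma IR_sign:
  assumes "model \<theta>1 \<theta>2 cH Q1" and r: "r \<in> {0..1}" "\<theta>1 * Q Q1 r 1 = r * cH" and x: "x \<in> {0..1}"
  shows "x < r \<Longrightarrow> 0 < payoff \<theta>1 cH Q1 1 x" and "r < x \<Longrightarrow> payoff \<theta>1 cH Q1 1 x < 0"
proof -
  have pos: "0 < \<theta>1" "content_function Q1" using assms(1) by (auto simp: model_def)
  define f where "f x = payoff \<theta>1 cH Q1 1 x" for x
  have f0: "0 < f 0" using Q_zero_pos[OF pos(2)] pos(1) by (simp add: f_def payoff_def)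
  have fr: "f r = 0" using r by (simp add: f_def payoff_def)
  have key: "(1 - t) * f 0 + t * f y \<le> f (t * y)" if "y \<in> {0..1}" "0 \<le> t" "t \<le> 1" for t y
  proof -
    have "\<forall>x\<in>{0..1}. \<forall>y\<in>{0..1}. \<forall>u\<ge>0. \<forall>v\<ge>0. u + v = 1 \<longrightarrow>
        u * Q Q1 x 1 + v * Q Q1 y 1 \<le> Q Q1 (u *\<^sub>R x + v *\<^sub>R y) 1"
      using concave_on_Q[OF pos(2)] unfolding concave_on_iff by auto
    from this[rule_format, of 0 y "1 - t" t] that
    have "(1 - t) * Q Q1 0 1 + t * Q Q1 y 1 \<le> Q Q1 (t * y) 1" by simp
    from mult_left_mono[OF this, of \<theta>1] pos(1) show ?thesis
      by (simp add: f_def payoff_def algebra_simps)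
  qed
  show "0 < payoff \<theta>1 cH Q1 1 x" if "x < r"
  proof -
    have "0 < (1 - x / r) * f 0" using that x f0 by simp
    with key[of r "x / r"] that x r fr show ?thesis by (simp add: f_def)
  qed
  show "payoff \<theta>1 cH Q1 1 x < 0" if "r < x"
  proof -
    have "0 < r" using f0 fr r by (cases "r = 0") auto
    have "0 < (1 - r / x) * f 0" using that r f0 by simp
    with key[of x "r / x"] that x r fr have "r / x * f x < 0" by simp
    with \<open>0 < r\<close> that show ?thesis by (simp add: f_def mult_less_0_iff divide_less_0_iff)
  qed
qed

lemma x_IR_eqI:
  assumes "model \<theta>1 \<theta>2 cH Q1" and r: "r \<in> {0..1}" "\<theta>1 * Q Q1 r 1 = r * cH"
  shows "x_IR \<theta>1 cH Q1 = r"
proof -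
  have "(THE x. x \<in> {0..1} \<and> \<theta>1 * Q Q1 x 1 = x * cH) = r"
  proof (rule the_equality)
    fix x assume "x \<in> {0..1} \<and> \<theta>1 * Q Q1 x 1 = x * cH"
    with IR_sign[OF assms, of x] show "x = r"
      by (cases x r rule: linorder_cases) (auto simp: payoff_def)
  qed (use r in auto)
  with r show ?thesis unfolding x_IR_def by auto
qed

lemma IR_iff_le_x_IR:
  assumes m: "model \<theta>1 \<theta>2 cH Q1" and x: "x \<in> {0..1}"
  shows "0 \<le> payoff \<theta>1 cH Q1 1 x \<longleftrightarrow> x \<le> x_IR \<theta>1 cH Q1"
proof (cases "\<exists>r\<in>{0..1}. \<theta>1 * Q Q1 r 1 = r * cH")
  case True
  then obtain r where r: "r \<in> {0..1}" "\<theta>1 * Q Q1 r 1 = r * cH" by blast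
  show ?thesis using IR_sign[OF m r x] r x_IR_eqI[OF m r]
    by (cases x r rule: linorder_cases) (auto simp: payoff_def)
next
  case False
  then have xr: "x_IR \<theta>1 cH Q1 = 1" by (simp add: x_IR_def)
  have cf: "content_function Q1" "0 < \<theta>1" using m by (auto simp: model_def)
  have c: "continuous_on {0..1} Q1" using cf by (simp add: content_function_def)
  have "continuous_on {0..1} (\<lambda>x. Q1 (1 - x))"
    by (rule continuous_on_compose2[OF c]) (auto intro!: continuous_intros)
  with c have cp: "continuous_on {0..1} (payoff \<theta>1 cH Q1 1)"
    unfolding payoff_def Q_def by (auto intro!: continuous_intros)
  have "0 \<le> payoff \<theta>1 cH Q1 1 x"
  proof (rule ccontr)
    assume neg: "\<not> ?thesis"
    have p0: "0 \<le> payoff \<theta>1 cH Q1 1 0"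
      using Q_zero_pos[OF cf(1)] cf(2) by (simp add: payoff_def)
    have "continuous_on {0..x} (payoff \<theta>1 cH Q1 1)"
      using cp x by (auto intro: continuous_on_subset)
    with IVT2'[of "payoff \<theta>1 cH Q1 1" x 0 0] p0 neg x obtain r where
      "0 \<le> r" "r \<le> x" "payoff \<theta>1 cH Q1 1 r = 0" by auto
    with False x show False by (auto simp: payoff_def)
  qed
  with xr x show ?thesis by simp
qed

end

theory Submission
  imports Defs
begin

text \<open>At equal flow, full participation is worth at least as much as half participation, because
  \<open>Q1\<close> is nondecreasing. Since \<open>SW\<close> is concave, it is nondecreasing up to \<open>xs\<close>, so \<open>x_IR\<close> is the
  best flow of full participation when \<open>x_IR < xs\<close>; the three regimes follow.
  If IR fails at \<open>xs\<close>, then \<open>SW xs \<le> \<theta>2/2 * Q xs 1\<close>, while half participation with flow 0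
  already yields \<open>\<theta>2/2 * Q1 (1/2)\<close> and \<open>Q xs 1 \<le> 2 * Q1 (1/2)\<close>; this gives the ratio \<open>1/2\<close>.
  It is approached for \<open>Q1 x = min (2 * x) 1\<close>, \<open>\<theta>2 = 1\<close>, \<open>cH = d\<close>, \<open>\<theta>1 = d\<^sup>2\<close> as \<open>d\<close> tends to 0:
  the threshold is then of order \<open>d\<close> although the optimum is \<open>1/2\<close>, and a half population gains
  nothing from splitting because \<open>Q1\<close> is linear on \<open>{0..1/2}\<close>.\<close>

section \<open>Shape of the welfare functions\<close>

lemma Q_sym: "Q Q1 (1 - x) 1 = Q Q1 x 1"
  by (simp add: Q_def)

text \<open>The total travel cost \<open>x * cH\<close> is the same on both sides; the larger
  population raises the content seen by type-2 users, and type-1 users add a nonnegative content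
  term.\<close>

lemma SW_half_le_SW:
  assumes m: "model \<theta>1 \<theta>2 cH Q1" and x: "x \<in> {0..1/2}"
  shows "SW_half \<theta>2 cH Q1 x \<le> SW \<theta>1 \<theta>2 cH Q1 x"
proof -
  have th: "0 < \<theta>1" "\<theta>1 < \<theta>2" and mono: "mono_on {0..1} Q1"
    and nn: "\<forall>x\<in>{0..1}. 0 \<le> Q1 x"
    using m by (auto simp: model_def content_function_def)
  have "Q1 (1/2 - x) \<le> Q1 (1 - x)" by (rule mono_onD[OF mono]) (use x in auto)
  then have "\<theta>2 / 2 * Q Q1 x (1/2) \<le> \<theta>2 / 2 * Q Q1 x 1"
    using th by (intro mult_left_mono) (auto simp: Q_def)
  moreover have "0 \<le> \<theta>1 / 2 * Q Q1 x 1"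
    using th nn x by (auto simp: Q_def intro!: mult_nonneg_nonneg add_nonneg_nonneg)
  ultimately show ?thesis by (simp add: SW_def SW_half_def field_simps)
qed

text \<open>An optimum above \<open>1/2\<close> would be beaten by its mirror image
  \<open>1 - xs\<close>, which has the same content and a lower travel cost.\<close>

lemma social_optimum_in_lower_half:
  assumes m: "model \<theta>1 \<theta>2 cH Q1" and o: "social_optimum \<theta>1 \<theta>2 cH Q1 xs"
  shows "xs \<in> {0..1/2}"
proof (rule ccontr)
  have xs: "xs \<in> {0..1}" and le: "\<And>y. y \<in> {0..1} \<Longrightarrow> SW \<theta>1 \<theta>2 cH Q1 y \<le> SW \<theta>1 \<theta>2 cH Q1 xs"
    using o unfolding social_optimum_def is_arg_max_linorder by auto
  assume "\<not> ?thesis"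
  then have "(1 - xs) * cH < xs * cH" using xs m by (auto simp: model_def)
  moreover have "SW \<theta>1 \<theta>2 cH Q1 (1 - xs) \<le> SW \<theta>1 \<theta>2 cH Q1 xs" by (rule le) (use xs in auto)
  ultimately show False by (simp add: SW_def Q_sym)
qed

lemma concave_on_SW:
  assumes m: "model \<theta>1 \<theta>2 cH Q1"
  shows "concave_on {0..1} (SW \<theta>1 \<theta>2 cH Q1)"
proof -
  have "content_function Q1" "0 \<le> (\<theta>1 + \<theta>2) / 2" using m by (auto simp: model_def)
  then have "concave_on {0..1} (\<lambda>x. (\<theta>1 + \<theta>2) / 2 * Q Q1 x 1)"
    by (intro concave_on_cmul concave_on_Q)
  moreover have "concave_on {0..1} (\<lambda>x. - (x * cH))"
    by (auto simp: concave_on_iff algebra_simps)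
  ultimately have "concave_on {0..1} (\<lambda>x. (\<theta>1 + \<theta>2) / 2 * Q Q1 x 1 + - (x * cH))"
    by (rule concave_on_add)
  then show ?thesis by (simp add: SW_def[abs_def])
qed

text \<open>A flow \<open>y\<close> between \<open>x\<close> and \<open>xs\<close> is a convex
  combination of the two, so concavity bounds \<open>SW\<close> at \<open>y\<close> below by the
  same combination of the values at \<open>x\<close> and \<open>xs\<close>, of which the value at
  \<open>xs\<close> is maximal.\<close>

lemma SW_mono_below_optimum:
  assumes m: "model \<theta>1 \<theta>2 cH Q1" and o: "social_optimum \<theta>1 \<theta>2 cH Q1 xs"
    and x: "0 \<le> x" "x \<le> y" "y \<le> xs"
  shows "SW \<theta>1 \<theta>2 cH Q1 x \<le> SW \<theta>1 \<theta>2 cH Q1 y"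
proof (cases "x < xs")
  case False
  with x have "x = y" by simp
  then show ?thesis by simp
next
  case True
  let ?S = "SW \<theta>1 \<theta>2 cH Q1"
  have xs: "xs \<in> {0..1}" and le: "?S x \<le> ?S xs"
    using o x unfolding social_optimum_def is_arg_max_linorder by auto
  define v where "v = (y - x) / (xs - x)"
  have v: "0 \<le> v" "v \<le> 1" using x True by (auto simp: v_def)
  have "v * (xs - x) = y - x" using True by (simp add: v_def)
  then have y: "y = (1 - v) *\<^sub>R x + v *\<^sub>R xs" by (simp add: algebra_simps)
  have "(1 - v) * ?S x + v * ?S xs \<le> ?S y"
    unfolding y using concave_on_SW[OF m] v xs x True unfolding concave_on_iff by auto
  moreover have "v * ?S x \<le> v * ?S xs" using le v by (intro mult_left_mono)
  ultimately show ?thesis by (simp add: algebra_simps)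
qed

section \<open>Optimal outcomes in the three regimes\<close>

text \<open>\<open>GREATEST\<close> is meaningful only for an attained maximum; an optimal outcome
  supplies one, so in each regime it suffices to exhibit such an outcome.\<close>

lemma SW_g_eq_welfare:
  assumes "optimal_outcome \<theta>1 \<theta>2 cH Q1 out"
  shows "SW_g \<theta>1 \<theta>2 cH Q1 = welfare \<theta>1 \<theta>2 cH Q1 out"
  unfolding SW_g_def
  by (rule Greatest_equality)
    (use assms in \<open>auto simp: optimal_outcome_def is_arg_max_linorder\<close>)

lemma optimal_outcomeI:
  assumes "admissible \<theta>1 cH Q1 out"
    and "\<And>x. \<lbrakk>0 \<le> x; x \<le> x_IR \<theta>1 cH Q1\<rbrakk> \<Longrightarrow> SW \<theta>1 \<theta>2 cH Q1 x \<le> welfare \<theta>1 \<theta>2 cH Q1 out"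
    and "\<And>x. \<lbrakk>x_IR \<theta>1 cH Q1 \<le> x; x \<le> 1/2\<rbrakk> \<Longrightarrow> SW_half \<theta>2 cH Q1 x \<le> welfare \<theta>1 \<theta>2 cH Q1 out"
  shows "optimal_outcome \<theta>1 \<theta>2 cH Q1 out"
  unfolding optimal_outcome_def is_arg_max_linorder
proof (intro conjI allI impI)
  fix out' assume "admissible \<theta>1 cH Q1 out'"
  with assms(2,3) show "welfare \<theta>1 \<theta>2 cH Q1 out' \<le> welfare \<theta>1 \<theta>2 cH Q1 out"
    by (cases out') auto
qed (fact assms(1))

lemma x_IR_nonneg:
  assumes m: "model \<theta>1 \<theta>2 cH Q1"
  shows "0 \<le> x_IR \<theta>1 cH Q1"
proof -
  have "0 \<le> payoff \<theta>1 cH Q1 1 0"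
    using m Q_zero_pos[of Q1] by (auto simp: model_def payoff_def)
  with IR_iff_le_x_IR[OF m, of 0] show ?thesis by simp
qed

lemma x_IR_le_1:
  assumes m: "model \<theta>1 \<theta>2 cH Q1"
  shows "x_IR \<theta>1 cH Q1 \<le> 1"
  using x_IR_eqI[OF m] by (cases "\<exists>x\<in>{0..1}. \<theta>1 * Q Q1 x 1 = x * cH") (auto simp: x_IR_def)

text \<open>A half outcome is compared first with full participation at the same flow, whether or
  not that is admissible, and then with \<open>xs\<close>.\<close>

lemma optimal_social_optimum:
  assumes m: "model \<theta>1 \<theta>2 cH Q1" and o: "social_optimum \<theta>1 \<theta>2 cH Q1 xs"
    and le: "xs \<le> x_IR \<theta>1 cH Q1"
  shows "optimal_outcome \<theta>1 \<theta>2 cH Q1 (Full xs)"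
proof (rule optimal_outcomeI)
  have xs: "xs \<in> {0..1}" and max: "\<And>y. y \<in> {0..1} \<Longrightarrow> SW \<theta>1 \<theta>2 cH Q1 y \<le> SW \<theta>1 \<theta>2 cH Q1 xs"
    using o unfolding social_optimum_def is_arg_max_linorder by auto
  show "admissible \<theta>1 cH Q1 (Full xs)" using xs le by simp
  show "SW \<theta>1 \<theta>2 cH Q1 x \<le> welfare \<theta>1 \<theta>2 cH Q1 (Full xs)" if "0 \<le> x" "x \<le> x_IR \<theta>1 cH Q1" for x
    using max[of x] that x_IR_le_1[OF m] by simp
  show "SW_half \<theta>2 cH Q1 x \<le> welfare \<theta>1 \<theta>2 cH Q1 (Full xs)"
    if "x_IR \<theta>1 cH Q1 \<le> x" "x \<le> 1/2" for x
    using SW_half_le_SW[OF m, of x] max[of x] that x_IR_nonneg[OF m] by simp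
qed

lemma optimal_full_participation:
  assumes m: "model \<theta>1 \<theta>2 cH Q1" and o: "social_optimum \<theta>1 \<theta>2 cH Q1 xs"
    and h: "half_optimum \<theta>2 cH Q1 xt" and less: "x_IR \<theta>1 cH Q1 < xs"
    and ge: "SW_half \<theta>2 cH Q1 xt \<le> SW \<theta>1 \<theta>2 cH Q1 (x_IR \<theta>1 cH Q1)"
  shows "optimal_outcome \<theta>1 \<theta>2 cH Q1 (Full (x_IR \<theta>1 cH Q1))"
proof (rule optimal_outcomeI)
  note r0 = x_IR_nonneg[OF m]
  show "admissible \<theta>1 cH Q1 (Full (x_IR \<theta>1 cH Q1))" using r0 by simp
  show "SW \<theta>1 \<theta>2 cH Q1 x \<le> welfare \<theta>1 \<theta>2 cH Q1 (Full (x_IR \<theta>1 cH Q1))"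
    if "0 \<le> x" "x \<le> x_IR \<theta>1 cH Q1" for x
    using SW_mono_below_optimum[OF m o that] less by simp
  show "SW_half \<theta>2 cH Q1 x \<le> welfare \<theta>1 \<theta>2 cH Q1 (Full (x_IR \<theta>1 cH Q1))"
    if "x_IR \<theta>1 cH Q1 \<le> x" "x \<le> 1/2" for x
    using h ge that r0 unfolding half_optimum_def is_arg_max_linorder
    by (auto intro: order_trans)
qed

lemma optimal_half_participation:
  assumes m: "model \<theta>1 \<theta>2 cH Q1" and o: "social_optimum \<theta>1 \<theta>2 cH Q1 xs"
    and h: "half_optimum \<theta>2 cH Q1 xt" and less: "x_IR \<theta>1 cH Q1 < xs"
    and gt: "SW \<theta>1 \<theta>2 cH Q1 (x_IR \<theta>1 cH Q1) < SW_half \<theta>2 cH Q1 xt"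
  shows "optimal_outcome \<theta>1 \<theta>2 cH Q1 (Half xt)"
proof (rule optimal_outcomeI)
  have xt: "xt \<in> {0..1/2}"
    and max: "\<And>y. y \<in> {0..1/2} \<Longrightarrow> SW_half \<theta>2 cH Q1 y \<le> SW_half \<theta>2 cH Q1 xt"
    using h unfolding half_optimum_def is_arg_max_linorder by auto
  have mono: "SW \<theta>1 \<theta>2 cH Q1 x \<le> SW \<theta>1 \<theta>2 cH Q1 (x_IR \<theta>1 cH Q1)"
    if "0 \<le> x" "x \<le> x_IR \<theta>1 cH Q1" for x
    using SW_mono_below_optimum[OF m o that] less by simp
  \<comment> \<open>If \<open>xt\<close> were below the threshold, full participation at
    \<open>xt\<close> would dominate it, and monotonicity would carry the bound on to
    \<open>x_IR\<close>, against \<open>gt\<close>.\<close>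
  have "x_IR \<theta>1 cH Q1 \<le> xt"
    using mono[of xt] SW_half_le_SW[OF m xt] xt gt by force
  with xt show "admissible \<theta>1 cH Q1 (Half xt)" by simp
  show "SW \<theta>1 \<theta>2 cH Q1 x \<le> welfare \<theta>1 \<theta>2 cH Q1 (Half xt)"
    if "0 \<le> x" "x \<le> x_IR \<theta>1 cH Q1" for x
    using mono[OF that] gt by simp
  show "SW_half \<theta>2 cH Q1 x \<le> welfare \<theta>1 \<theta>2 cH Q1 (Half xt)"
    if "x_IR \<theta>1 cH Q1 \<le> x" "x \<le> 1/2" for x
    using max[of x] that x_IR_nonneg[OF m] by simp
qed

section \<open>Lower bound on the welfare ratio\<close>

text \<open>The ratio bound does not assume a half optimum, so compactness must provide one before
  the regimes apply.\<close>

lemma half_optimum_exists: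
  assumes m: "model \<theta>1 \<theta>2 cH Q1"
  shows "\<exists>xt. half_optimum \<theta>2 cH Q1 xt"
proof -
  have c: "continuous_on {0..1} Q1" using m by (auto simp: model_def content_function_def)
  have "continuous_on {0..1/2} Q1" using c by (rule continuous_on_subset) auto
  moreover have "continuous_on {0..1/2} (\<lambda>x. Q1 (1/2 - x))"
    by (rule continuous_on_compose2[OF c]) (auto intro!: continuous_intros)
  ultimately have "continuous_on {0..1/2} (SW_half \<theta>2 cH Q1)"
    unfolding SW_half_def Q_def by (auto intro!: continuous_intros)
  from continuous_attains_sup[OF _ _ this] show ?thesis
    unfolding half_optimum_def is_arg_max_linorder by auto
qed

lemma social_optimum_pos:
  assumes m: "model \<theta>1 \<theta>2 cH Q1" and o: "social_optimum \<theta>1 \<theta>2 cH Q1 xs"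
  shows "0 < SW \<theta>1 \<theta>2 cH Q1 xs"
proof -
  have "0 < SW \<theta>1 \<theta>2 cH Q1 0"
    using m Q_zero_pos[of Q1] by (auto simp: model_def SW_def)
  moreover have "SW \<theta>1 \<theta>2 cH Q1 0 \<le> SW \<theta>1 \<theta>2 cH Q1 xs"
    using o unfolding social_optimum_def is_arg_max_linorder by auto
  ultimately show ?thesis by simp
qed

text \<open>Dropping the negative type-1 payoff from \<open>SW\<close> leaves half the type-2
  payoff. Its content is at most that of the even split, which is twice what the half population
  gets at flow 0.\<close>

lemma half_social_optimum_le_SW_half_zero:
  assumes m: "model \<theta>1 \<theta>2 cH Q1" and o: "social_optimum \<theta>1 \<theta>2 cH Q1 xs"
    and less: "x_IR \<theta>1 cH Q1 < xs"
  shows "SW \<theta>1 \<theta>2 cH Q1 xs / 2 \<le> SW_half \<theta>2 cH Q1 0"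
proof -
  have th: "0 < \<theta>1" "\<theta>1 < \<theta>2" "0 < cH" and z: "Q1 0 = 0"
    and s: "strict_mono_on {0..1/2} (\<lambda>x. Q Q1 x 1)"
    using m by (auto simp: model_def content_function_def)
  have xs: "xs \<in> {0..1/2}" by (rule social_optimum_in_lower_half[OF m o])
  have "Q Q1 xs 1 \<le> Q Q1 (1/2) 1"
    by (rule mono_onD[OF strict_mono_on_imp_mono_on[OF s]]) (use xs in auto)
  then have "\<theta>2 / 2 * Q Q1 xs 1 \<le> \<theta>2 / 2 * (2 * Q1 (1/2))"
    using th by (intro mult_left_mono) (auto simp: Q_def)
  moreover have "payoff \<theta>1 cH Q1 1 xs < 0"
    using IR_iff_le_x_IR[OF m, of xs] xs less by auto
  moreover have "0 \<le> xs * cH" using xs th by simp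
  ultimately show ?thesis using z
    by (simp add: SW_def SW_half_def payoff_def Q_def field_simps)
qed

lemma SW_g_ge_half:
  assumes m: "model \<theta>1 \<theta>2 cH Q1" and o: "social_optimum \<theta>1 \<theta>2 cH Q1 xs"
  shows "1/2 \<le> SW_g \<theta>1 \<theta>2 cH Q1 / SW \<theta>1 \<theta>2 cH Q1 xs"
proof -
  note pos = social_optimum_pos[OF m o]
  have "SW \<theta>1 \<theta>2 cH Q1 xs / 2 \<le> SW_g \<theta>1 \<theta>2 cH Q1"
  proof (cases "xs \<le> x_IR \<theta>1 cH Q1")
    case True
    then show ?thesis using SW_g_eq_welfare[OF optimal_social_optimum[OF m o]] pos by simp
  next
    case False
    then have less: "x_IR \<theta>1 cH Q1 < xs" by simp
    obtain xt where h: "half_optimum \<theta>2 cH Q1 xt" using half_optimum_exists[OF m] by blast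
    have "SW_half \<theta>2 cH Q1 0 \<le> SW_half \<theta>2 cH Q1 xt"
      using h unfolding half_optimum_def is_arg_max_linorder by auto
    \<comment> \<open>\<open>Half 0\<close> is itself inadmissible, as type-1 users gain strictly at
      flow 0. The bound passes through \<open>xt\<close>, whose welfare is at most
      \<open>SW_g\<close> in both remaining regimes.\<close>
    moreover have "SW_half \<theta>2 cH Q1 xt \<le> SW_g \<theta>1 \<theta>2 cH Q1"
      using SW_g_eq_welfare[OF optimal_full_participation[OF m o h less]]
        SW_g_eq_welfare[OF optimal_half_participation[OF m o h less]]
      by (cases "SW_half \<theta>2 cH Q1 xt \<le> SW \<theta>1 \<theta>2 cH Q1 (x_IR \<theta>1 cH Q1)") auto
    ultimately show ?thesis using half_social_optimum_le_SW_half_zero[OF m o less] by simp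
  qed
  then show ?thesis using pos by (simp add: field_simps)
qed

section \<open>A family of instances approaching the bound\<close>

definition capped_content :: "real \<Rightarrow> real" where
  "capped_content x = min (2 * x) 1"

text \<open>Path L then carries a mass of at least \<open>1/2\<close>, so its content is saturated
  at 1.\<close>

lemma Q_capped_lower: "x \<in> {0..1/2} \<Longrightarrow> Q capped_content x 1 = 1 + 2 * x"
  by (auto simp: Q_def capped_content_def min_def)

lemma content_function_capped: "content_function capped_content"
  unfolding content_function_def
proof (intro conjI)
  show "continuous_on {0..1} capped_content"
    unfolding capped_content_def by (intro continuous_intros)
  show "mono_on {0..1} capped_content"
    by (rule mono_onI) (auto simp: capped_content_def min_def)
  show "strict_mono_on {0..1/2} (\<lambda>x. Q capped_content x 1)"
    by (rule strict_mono_onI) (simp add: Q_capped_lower)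
  show "concave_on {0..1} capped_content"
    unfolding concave_on_iff
  proof (intro conjI ballI allI impI)
    fix x y u v :: real
    assume a: "0 \<le> u" "0 \<le> v" "u + v = 1"
    have "u * capped_content x + v * capped_content y \<le> u * (2 * x) + v * (2 * y)"
      "u * capped_content x + v * capped_content y \<le> u * 1 + v * 1"
      unfolding capped_content_def using a by (intro add_mono mult_left_mono; simp)+
    with a show "u * capped_content x + v * capped_content y \<le> capped_content (u *\<^sub>R x + v *\<^sub>R y)"
      by (simp add: capped_content_def)
  qed simp
qed (auto simp: capped_content_def)

lemma capped_ratio:
  fixes d :: real
  assumes d: "0 < d" "d < 1/4"
  shows "(1 - d\<^sup>2) / (2 * (1 - 2 * d)) / (1 + d\<^sup>2 - d / 2) \<in> welfare_ratios"
proof -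
  let ?Q = capped_content
  \<comment> \<open>Solves the IR equation \<open>d\<^sup>2 * (1 + 2 * r) = r * d\<close>; the bound
    \<open>d < 1/4\<close> is what puts it below \<open>1/2\<close>.\<close>
  let ?r = "d / (1 - 2 * d)"
  have d2: "d\<^sup>2 < 1" using d by (simp add: power_less_one_iff)
  have m: "model (d\<^sup>2) 1 d ?Q"
    using d d2 content_function_capped by (simp add: model_def)
  have r: "?r \<in> {0..1/2}" "?r \<in> {0..1}" "?r < 1/2" using d by (auto simp: field_simps)
  have xr: "x_IR (d\<^sup>2) d ?Q = ?r"
  proof (rule x_IR_eqI[OF m])
    show "d\<^sup>2 * Q ?Q ?r 1 = ?r * d"
      unfolding Q_capped_lower[OF r(1)] using d by (simp add: field_simps power2_eq_square)
  qed (fact r(2))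
  have SW_lower: "SW (d\<^sup>2) 1 d ?Q x = (d\<^sup>2 + 1) / 2 + (d\<^sup>2 + 1 - d) * x" if "x \<in> {0..1/2}" for x
    using that by (simp add: SW_def Q_capped_lower field_simps)
  \<comment> \<open>On the lower half \<open>SW\<close> is affine with nonnegative slope; a flow
    above \<open>1/2\<close> is no better than its reflection \<open>1 - x\<close>.\<close>
  have le: "SW (d\<^sup>2) 1 d ?Q x \<le> SW (d\<^sup>2) 1 d ?Q (1/2)" if x: "x \<in> {0..1}" for x
  proof -
    have half: "SW (d\<^sup>2) 1 d ?Q y \<le> SW (d\<^sup>2) 1 d ?Q (1/2)" if y: "y \<in> {0..1/2}" for y
    proof -
      have "0 \<le> d\<^sup>2 + 1 - d" using d zero_le_power2[of d] by linarith
      then have "(d\<^sup>2 + 1 - d) * y \<le> (d\<^sup>2 + 1 - d) * (1/2)"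
        using y by (intro mult_left_mono) auto
      with y show ?thesis by (simp add: SW_lower)
    qed
    show ?thesis
    proof (cases "x \<le> 1/2")
      case False
      then have "(1 - x) * d \<le> x * d" using d by (intro mult_right_mono) auto
      then have "SW (d\<^sup>2) 1 d ?Q x \<le> SW (d\<^sup>2) 1 d ?Q (1 - x)" by (simp add: SW_def Q_sym)
      with half[of "1 - x"] False x show ?thesis by simp
    qed (use half x in auto)
  qed
  have o: "social_optimum (d\<^sup>2) 1 d ?Q (1/2)"
    unfolding social_optimum_def is_arg_max_linorder using le by auto
  have SWh: "SW_half 1 d ?Q x = 1/2 - x * d" if "x \<in> {0..1/2}" for x
    using that by (simp add: SW_half_def Q_def capped_content_def)
  have h: "half_optimum 1 d ?Q 0"
    unfolding half_optimum_def is_arg_max_linorder using d by (auto simp: SWh)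
  have SWr: "SW (d\<^sup>2) 1 d ?Q ?r = (1 - d\<^sup>2) / (2 * (1 - 2 * d))"
    unfolding SW_lower[OF r(1)] using d
    by (simp add: divide_simps) (simp add: algebra_simps power2_eq_square)
  \<comment> \<open>After clearing denominators the comparison that selects full participation reads
    \<open>d * d \<le> 2 * d\<close>.\<close>
  have "d * d \<le> d * 1" using d by (intro mult_left_mono) auto
  then have ge: "SW_half 1 d ?Q 0 \<le> SW (d\<^sup>2) 1 d ?Q ?r"
    unfolding SWr using d by (simp add: SWh field_simps power2_eq_square)
  have "SW_g (d\<^sup>2) 1 d ?Q = SW (d\<^sup>2) 1 d ?Q ?r"
    using SW_g_eq_welfare[OF optimal_full_participation[OF m o h]] r ge by (simp add: xr)
  moreover have "SW (d\<^sup>2) 1 d ?Q (1/2) = 1 + d\<^sup>2 - d / 2"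
    by (simp add: SW_lower field_simps)
  ultimately have "(1 - d\<^sup>2) / (2 * (1 - 2 * d)) / (1 + d\<^sup>2 - d / 2)
      = SW_g (d\<^sup>2) 1 d ?Q / SW (d\<^sup>2) 1 d ?Q (1/2)"
    by (simp only: SWr)
  with m o show ?thesis unfolding welfare_ratios_def by blast
qed

section \<open>The infimum of the ratios\<close>

lemma welfare_ratios_ge: "w \<in> welfare_ratios \<Longrightarrow> 1/2 \<le> w"
  unfolding welfare_ratios_def using SW_g_ge_half by blast

text \<open>Ensures that the real \<open>Inf\<close> in \<open>PoA_g\<close> is a genuine
  infimum.\<close>

lemma bdd_below_welfare_ratios: "bdd_below welfare_ratios"
  using welfare_ratios_ge by (rule bdd_belowI)

lemma PoA_g_eq_half: "PoA_g = 1/2"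
  unfolding PoA_g_def
proof (rule antisym)
  let ?f = "\<lambda>d::real. (1 - d\<^sup>2) / (2 * (1 - 2 * d)) / (1 + d\<^sup>2 - d / 2)"
  \<comment> \<open>The ratios are available only for \<open>0 < d < 1/4\<close>, hence the
    one-sided limit; \<open>?f\<close> is continuous at 0 with value \<open>1/2\<close>.\<close>
  have "(?f \<longlongrightarrow> ?f 0) (at_right 0)"
    by (intro tendsto_intros) auto
  moreover have "\<forall>\<^sub>F d in at_right 0. Inf welfare_ratios \<le> ?f d"
    using eventually_at_right_real[of 0 "1/4", simplified]
    by (rule eventually_mono) (rule cInf_lower[OF capped_ratio bdd_below_welfare_ratios]; simp)
  ultimately have "Inf welfare_ratios \<le> ?f 0"
    by (rule tendsto_lowerbound) simp
  then show "Inf welfare_ratios \<le> 1/2" by simp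
  have "welfare_ratios \<noteq> {}" using capped_ratio[of "1/8"] by auto
  then show "1/2 \<le> Inf welfare_ratios" by (rule cInf_greatest) (rule welfare_ratios_ge)
qed

theorem theorem1:
  shows "(\<forall>\<theta>1 \<theta>2 cH Q1 xs xt.
      model \<theta>1 \<theta>2 cH Q1 \<and> social_optimum \<theta>1 \<theta>2 cH Q1 xs \<and> half_optimum \<theta>2 cH Q1 xt \<longrightarrow>
        (xs \<le> x_IR \<theta>1 cH Q1 \<longrightarrow>
           optimal_outcome \<theta>1 \<theta>2 cH Q1 (Full xs) \<and>
           SW_g \<theta>1 \<theta>2 cH Q1 = SW \<theta>1 \<theta>2 cH Q1 xs) \<and>
        (x_IR \<theta>1 cH Q1 < xs \<and>
         SW_half \<theta>2 cH Q1 xt \<le> SW \<theta>1 \<theta>2 cH Q1 (x_IR \<theta>1 cH Q1) \<longrightarrow>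
           optimal_outcome \<theta>1 \<theta>2 cH Q1 (Full (x_IR \<theta>1 cH Q1)) \<and>
           SW_g \<theta>1 \<theta>2 cH Q1 = SW \<theta>1 \<theta>2 cH Q1 (x_IR \<theta>1 cH Q1)) \<and>
        (x_IR \<theta>1 cH Q1 < xs \<and>
         SW \<theta>1 \<theta>2 cH Q1 (x_IR \<theta>1 cH Q1) < SW_half \<theta>2 cH Q1 xt \<longrightarrow>
           optimal_outcome \<theta>1 \<theta>2 cH Q1 (Half xt) \<and>
           SW_g \<theta>1 \<theta>2 cH Q1 = SW_half \<theta>2 cH Q1 xt))
    \<and> bdd_below welfare_ratios \<and> PoA_g = 1/2"
proof (intro conjI allI impI; (elim conjE)?)
  fix \<theta>1 \<theta>2 cH Q1 xs xt
  assume m: "model \<theta>1 \<theta>2 cH Q1" and o: "social_optimum \<theta>1 \<theta>2 cH Q1 xs"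
    and h: "half_optimum \<theta>2 cH Q1 xt"
  {
    assume "xs \<le> x_IR \<theta>1 cH Q1"
    from optimal_social_optimum[OF m o this]
    show "optimal_outcome \<theta>1 \<theta>2 cH Q1 (Full xs)"
      and "SW_g \<theta>1 \<theta>2 cH Q1 = SW \<theta>1 \<theta>2 cH Q1 xs"
      by (auto dest: SW_g_eq_welfare)
  next
    assume "x_IR \<theta>1 cH Q1 < xs"
      and "SW_half \<theta>2 cH Q1 xt \<le> SW \<theta>1 \<theta>2 cH Q1 (x_IR \<theta>1 cH Q1)"
    from optimal_full_participation[OF m o h this]
    show "optimal_outcome \<theta>1 \<theta>2 cH Q1 (Full (x_IR \<theta>1 cH Q1))"
      and "SW_g \<theta>1 \<theta>2 cH Q1 = SW \<theta>1 \<theta>2 cH Q1 (x_IR \<theta>1 cH Q1)"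
      by (auto dest: SW_g_eq_welfare)
  next
    assume "x_IR \<theta>1 cH Q1 < xs"
      and "SW \<theta>1 \<theta>2 cH Q1 (x_IR \<theta>1 cH Q1) < SW_half \<theta>2 cH Q1 xt"
    from optimal_half_participation[OF m o h this]
    show "optimal_outcome \<theta>1 \<theta>2 cH Q1 (Half xt)"
      and "SW_g \<theta>1 \<theta>2 cH Q1 = SW_half \<theta>2 cH Q1 xt"
      by (auto dest: SW_g_eq_welfare)
  }
qed (fact bdd_below_welfare_ratios PoA_g_eq_half)+

end
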